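(* For $n \geq 4$ and $k \geq 2$ we have $ex(n;k) = \lfloor \frac{n^2}{4} \rfloor$.
   Context: A digraph has a vertex set and an arc set consisting of ordered pairs of distinct vertices. A walk of length $\ell$ is a sequence $x_0x_1\dots x_\ell$ of vertices with $x_i \rightarrow x_{i+1}$ for all $i$. A digraph is $k$-geodetic if for every ordered pair $(u,v)$ of (not necessarily distinct) vertices there is at most one $u,v$-walk of length at most $k$. For $n,k\ge 2$, $ex(n;k)$ is the largest possible number of arcs of a $k$-geodetic digraph on $n$ vertices. *)

theory Defs
  imports "Graph_Theory.Pair_Digraph" "Graph_Theory.Vertex_Walk"
begin

text \<open>
  The vertices \<open>u\<close> and \<open>v\<close> may coincide and \<open>[u]\<close> is a walk of length 0 from \<open>u\<close> to \<open>u\<close>, so a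
  \<open>k\<close>-geodetic digraph has no closed walk of length between 1 and \<open>k\<close>.
\<close>

definition k_geodetic :: "nat \<Rightarrow> 'a pair_pre_digraph \<Rightarrow> bool" where
  "k_geodetic k G \<longleftrightarrow>
    (\<forall>u \<in> pverts G. \<forall>v \<in> pverts G. \<forall>p q.
      vwalk p (with_proj G) \<and> hd p = u \<and> last p = v \<and> vwalk_length p \<le> k \<and>
      vwalk q (with_proj G) \<and> hd q = u \<and> last q = v \<and> vwalk_length q \<le> k \<longrightarrow> p = q)"

definition geodetic_sizes :: "nat \<Rightarrow> nat \<Rightarrow> nat set" where
  "geodetic_sizes n k =
    {card (parcs G) | G :: nat pair_pre_digraph.
      pair_digraph G \<and> card (pverts G) = n \<and> k_geodetic k G}"

definition ex :: "nat \<Rightarrow> nat \<Rightarrow> nat" where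
  "ex n k = Max (geodetic_sizes n k)"

text \<open>
  The set of sizes is finite and nonempty, so the maximum is attained; taking the vertices from
  \<^typ>\<open>nat\<close> is no restriction, since the bound holds for digraphs on any vertex type.
\<close>

lemma finite_geodetic_sizes: "finite (geodetic_sizes n k)"
proof (rule finite_subset)
  show "geodetic_sizes n k \<subseteq> {..n * n}"
  proof
    fix m assume "m \<in> geodetic_sizes n k"
    then obtain G :: "nat pair_pre_digraph"
      where G: "m = card (parcs G)" "pair_digraph G" "card (pverts G) = n"
      by (auto simp: geodetic_sizes_def)
    interpret pair_digraph G by fact
    have "parcs G \<subseteq> pverts G \<times> pverts G"
      by (auto intro: in_arcsD1 in_arcsD2)
    then have "card (parcs G) \<le> card (pverts G \<times> pverts G)"
      by (intro card_mono) (auto intro: pair_finite_verts)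
    then show "m \<in> {..n * n}"
      using G by (simp add: card_cartesian_product)
  qed
qed simp

lemma geodetic_sizes_nonempty: "geodetic_sizes n k \<noteq> {}"
proof -
  define G :: "nat pair_pre_digraph" where "G = \<lparr>pverts = {..<n}, parcs = {}\<rparr>"
  have "pair_digraph G"
    by unfold_locales (auto simp: G_def)
  moreover have "p = [hd p]" if "vwalk p (with_proj G)" for p
    using that by (cases p rule: vwalk_arcs.cases) (auto simp: vwalk_def G_def)
  then have "k_geodetic k G"
    unfolding k_geodetic_def by metis
  moreover have "card (pverts G) = n"
    by (simp add: G_def)
  ultimately have "card (parcs G) \<in> geodetic_sizes n k"
    unfolding geodetic_sizes_def by blast
  then show ?thesis by blast
qed

lemma vwalk_arcs_map: "vwalk_arcs (map g p) = map (map_prod g g) (vwalk_arcs p)"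
  by (induction p rule: vwalk_arcs.induct) auto

lemma card_parcs_le_ex:
  fixes G :: "'a pair_pre_digraph"
  assumes "pair_digraph G" and card_V: "card (pverts G) = n" and geo: "k_geodetic k G"
  shows "card (parcs G) \<le> ex n k"
proof -
  interpret pair_digraph G by fact
  obtain f :: "'a \<Rightarrow> nat" where f: "inj_on f (pverts G)"
    using finite_imp_inj_to_nat_seg[OF pair_finite_verts] by blast
  define g where "g = inv_into (pverts G) f"
  define H where "H = \<lparr>pverts = f ` pverts G, parcs = map_prod f f ` parcs G\<rparr>"
  have A: "parcs G \<subseteq> pverts G \<times> pverts G"
    by (auto intro: in_arcsD1 in_arcsD2)
  have gf: "g (f x) = x" if "x \<in> pverts G" for x
    using f that by (simp add: g_def)
  have inj_g: "inj_on g (pverts H)"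
    by (auto simp: inj_on_def H_def gf)
  have inj: "inj_on (map_prod f f) (parcs G)"
    using map_prod_inj_on[OF f f] A by (rule inj_on_subset)
  have "pair_digraph H"
  proof unfold_locales
    fix e assume "e \<in> parcs H"
    then obtain x y where e: "e = (f x, f y)" "(x, y) \<in> parcs G"
      by (auto simp: H_def)
    then have xy: "x \<in> pverts G" "y \<in> pverts G" "x \<noteq> y"
      using A pair_no_loops[OF e(2)] by auto
    then show "fst e \<in> pverts H" "snd e \<in> pverts H" "fst e \<noteq> snd e"
      using e f by (auto simp: H_def inj_on_def)
  qed (auto simp: H_def pair_finite_verts pair_finite_arcs)
  moreover have "card (pverts H) = n"
    using card_V f by (simp add: H_def card_image)
  moreover have "k_geodetic k H"
    unfolding k_geodetic_def
  proof (intro ballI allI impI, elim conjE)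
    fix u v p q
    assume p: "vwalk p (with_proj H)" "hd p = u" "last p = v" "vwalk_length p \<le> k"
      and q: "vwalk q (with_proj H)" "hd q = u" "last q = v" "vwalk_length q \<le> k"
      and uv: "u \<in> pverts H" "v \<in> pverts H"
    have walk: "vwalk (map g r) (with_proj G)" if r: "vwalk r (with_proj H)" for r
    proof (rule vwalkI)
      show "set (map g r) \<subseteq> verts (with_proj G)"
        using r gf by (fastforce simp: vwalk_def H_def)
      have "map_prod g g e \<in> parcs G" if "e \<in> parcs H" for e
        using that A gf by (auto simp: H_def)
      then show "set (vwalk_arcs (map g r)) \<subseteq> arcs_ends (with_proj G)"
        using r by (auto simp: vwalk_def vwalk_arcs_map)
      show "map g r \<noteq> []"
        using r by (auto simp: vwalk_def)
    qed
    have ne: "p \<noteq> []" "q \<noteq> []"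
      using p q by (auto simp: vwalk_def)
    have "g u \<in> pverts G" "g v \<in> pverts G"
      using uv gf by (auto simp: H_def)
    moreover have "hd (map g p) = g u" "last (map g p) = g v"
      "hd (map g q) = g u" "last (map g q) = g v"
      using p q ne by (auto simp: hd_map last_map)
    ultimately have "map g p = map g q"
      using geo walk[OF p(1)] walk[OF q(1)] p(4) q(4)
      unfolding k_geodetic_def by (metis length_map vwalk_length_simp)
    moreover have "set p \<union> set q \<subseteq> pverts H"
      using p q by (auto simp: vwalk_def)
    ultimately show "p = q"
      using inj_g by (meson inj_on_subset inj_on_map_eq_map)
  qed
  ultimately have "card (parcs H) \<in> geodetic_sizes n k"
    unfolding geodetic_sizes_def by blast
  moreover have "card (parcs H) = card (parcs G)"
    using inj by (simp add: H_def card_image)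
  ultimately show ?thesis
    unfolding ex_def using finite_geodetic_sizes by (metis Max_ge)
qed

end

theory Submission
  imports Defs
begin

text \<open>
  In the underlying graph of a 2-geodetic digraph every edge lies in at most one triangle: all
  triangles are cyclically oriented, so two of them on an arc \<open>u \<rightarrow> v\<close> would give two walks of
  length 2 from \<open>v\<close> to \<open>u\<close>. Hence every vertex outside a triangle \<open>T\<close> sends at most one arc to or
  from \<open>T\<close>, and deleting \<open>T\<close> from a digraph on \<open>n\<close> vertices costs at most \<open>n\<close> arcs. This settles
  the upper bound by induction, down to Mantel's theorem for the triangle-free case. Orienting a
  balanced complete bipartite graph from one side to the other attains the bound for every \<open>k\<close>.
\<close>

text \<open>\<open>A\<close>, its converse and the diagonal are pairwise disjoint inside
  \<open>T \<times> T\<close>. The lemma is applied to a deleted edge, with at most 1 arc, and to a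
  deleted triangle, with at most 3.\<close>

lemma card_asym_le:
  assumes "finite T" "A \<subseteq> T \<times> T" "asym A"
  shows "2 * card A + card T \<le> (card T)\<^sup>2"
proof -
  have fin: "finite A"
    using assms finite_subset by blast
  have disj: "A \<inter> A\<inverse> = {}" "(A \<union> A\<inverse>) \<inter> Id_on T = {}"
    using \<open>asym A\<close> by (auto dest: asymD)
  have "card (Id_on T) = card T"
    by (rule bij_betw_same_card[of fst]) (force simp: bij_betw_def inj_on_def)
  moreover have "finite (Id_on T)"
    using assms by (auto simp: Id_on_def)
  ultimately have "2 * card A + card T = card (A \<union> A\<inverse> \<union> Id_on T)"
    using fin disj by (simp add: card_Un_disjoint)
  also have "\<dots> \<le> card (T \<times> T)"
    using assms by (intro card_mono) auto
  finally show ?thesis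
    by (simp add: card_cartesian_product power2_eq_square)
qed

text \<open>Sending each arc between \<open>T\<close> and \<open>V - T\<close> to its endpoint
  outside \<open>T\<close> is injective: \<open>nbr\<close> fixes the other endpoint and asymmetry
  fixes the direction.\<close>

lemma card_arcs_delete_le:
  assumes V: "finite V" "A \<subseteq> V \<times> V" "asym A" and "T \<subseteq> V"
    and nbr: "\<And>x y z. \<lbrakk>x \<in> V - T; y \<in> T; z \<in> T; (x, y) \<in> A \<union> A\<inverse>; (x, z) \<in> A \<union> A\<inverse>\<rbrakk> \<Longrightarrow> y = z"
  shows "card A \<le> card (A \<inter> T \<times> T) + card (V - T) + card (A \<inter> (V - T) \<times> (V - T))"
proof -
  define C where "C = A \<inter> (T \<times> (V - T) \<union> (V - T) \<times> T)"
  define f where "f = (\<lambda>(a, b). if a \<in> T then b else a)"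
  have fin: "finite A"
    using V finite_subset by blast
  have "inj_on f C"
  proof (rule inj_onI)
    have ends: "\<exists>y \<in> T. f e \<in> V - T \<and> e \<in> A \<and> (e = (f e, y) \<or> e = (y, f e))" if "e \<in> C" for e
      using that V(2) by (auto simp: C_def f_def)
    fix e e' assume *: "e \<in> C" "e' \<in> C" "f e = f e'"
    obtain y z where y: "y \<in> T" "e = (f e, y) \<or> e = (y, f e)"
      and z: "z \<in> T" "e' = (f e, z) \<or> e' = (z, f e)"
      and A: "f e \<in> V - T" "e \<in> A" "e' \<in> A"
      using ends[OF *(1)] ends[OF *(2)] *(3) by auto
    have "y = z"
      by (rule nbr[OF A(1) y(1) z(1)]) (use y(2) z(2) A in auto)
    then show "e = e'"
      using y(2) z(2) A asymD[OF \<open>asym A\<close>] by metis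
  qed
  then have "card C = card (f ` C)"
    by (simp add: card_image)
  also have "\<dots> \<le> card (V - T)"
    using V by (intro card_mono) (auto simp: C_def f_def)
  finally have "card C \<le> card (V - T)" .
  moreover have "A = (A \<inter> T \<times> T) \<union> C \<union> (A \<inter> (V - T) \<times> (V - T))"
    using V \<open>T \<subseteq> V\<close> by (auto simp: C_def)
  then have "card A \<le> card (A \<inter> T \<times> T) + card C + card (A \<inter> (V - T) \<times> (V - T))"
    by (metis card_Un_le add_le_mono1 order_trans)
  ultimately show ?thesis by linarith
qed

text \<open>Deleting both ends of an edge leaves m vertices and costs at most m + 1 arcs, while (m +
  2)^2 = m^2 + 4 (m + 1). The factor 4 keeps rounding out of the induction.\<close>

lemma mantel:
  assumes "finite V" "A \<subseteq> V \<times> V" "asym A"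
    and "\<And>x y z. \<lbrakk>(x, y) \<in> A \<union> A\<inverse>; (y, z) \<in> A \<union> A\<inverse>\<rbrakk> \<Longrightarrow> (x, z) \<notin> A \<union> A\<inverse>"
  shows "4 * card A \<le> (card V)\<^sup>2"
  using assms
proof (induction "card V" arbitrary: V A rule: less_induct)
  case less
  note V = less.prems(1-3)
  show ?case
  proof (cases "A = {}")
    case False
    then obtain u v where uv: "(u, v) \<in> A" by auto
    define T where "T = {u, v}"
    let ?B = "A \<inter> (V - T) \<times> (V - T)"
    have "u \<noteq> v"
      using uv V(3) by (auto dest: asymD)
    then have T: "T \<subseteq> V" "card T = 2" "finite T"
      using uv V(2) by (auto simp: T_def)
    then have cV: "card V = card (V - T) + 2"
      using V by (metis card_Diff_subset card_mono le_add_diff_inverse2)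
    have "card A \<le> card (A \<inter> T \<times> T) + card (V - T) + card ?B"
    proof (rule card_arcs_delete_le[OF V T(1)])
      fix x y z
      assume "x \<in> V - T" "y \<in> T" "z \<in> T" "(x, y) \<in> A \<union> A\<inverse>" "(x, z) \<in> A \<union> A\<inverse>"
      \<comment> \<open>A vertex adjacent to both \<open>u\<close> and \<open>v\<close> would close
        a triangle on the edge \<open>uv\<close>.\<close>
      then show "y = z"
        using less.prems(4)[of y x z] uv by (auto simp: T_def)
    qed
    moreover have asym: "asym (A \<inter> X)" for X
      using V(3) by (auto simp: asym_on_def)
    have "2 * card (A \<inter> T \<times> T) + card T \<le> (card T)\<^sup>2"
      using T asym by (intro card_asym_le) auto
    moreover have "4 * card ?B \<le> (card (V - T))\<^sup>2"
    proof (intro less.hyps asym)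
      fix x y z
      assume "(x, y) \<in> ?B \<union> ?B\<inverse>" "(y, z) \<in> ?B \<union> ?B\<inverse>"
      then show "(x, z) \<notin> ?B \<union> ?B\<inverse>"
        using less.prems(4)[of x y z] by blast
    qed (use cV V(1) in auto)
    ultimately have "4 * card A \<le> 4 + 4 * card (V - T) + (card (V - T))\<^sup>2"
      using T by simp
    then show ?thesis
      using cV by (simp add: power2_eq_square algebra_simps)
  qed simp
qed

text \<open>The exceptional case is the triangle itself.\<close>

lemma card_arcs_le_if_unique_triangles:
  assumes "finite V" "A \<subseteq> V \<times> V" "asym A"
    and "\<And>u v w w'. \<lbrakk>(u, v) \<in> A \<union> A\<inverse>; (u, w) \<in> A \<union> A\<inverse>; (v, w) \<in> A \<union> A\<inverse>;
      (u, w') \<in> A \<union> A\<inverse>; (v, w') \<in> A \<union> A\<inverse>\<rbrakk> \<Longrightarrow> w = w'"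
  shows "card A \<le> (card V)\<^sup>2 div 4 + of_bool (card V = 3)"
  using assms
proof (induction "card V" arbitrary: V A rule: less_induct)
  case less
  note V = less.prems(1-3)
  show ?case
  proof (cases "\<exists>x y z. (x, y) \<in> A \<union> A\<inverse> \<and> (y, z) \<in> A \<union> A\<inverse> \<and> (x, z) \<in> A \<union> A\<inverse>")
    case False
    then have "4 * card A \<le> (card V)\<^sup>2"
      using V by (intro mantel) blast+
    then show ?thesis by simp
  next
    case True
    then obtain a b c where
      abc: "(a, b) \<in> A \<union> A\<inverse>" "(b, c) \<in> A \<union> A\<inverse>" "(a, c) \<in> A \<union> A\<inverse>" by blast
    define T where "T = {a, b, c}"
    let ?B = "A \<inter> (V - T) \<times> (V - T)"
    have "a \<noteq> b" "b \<noteq> c" "a \<noteq> c"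
      using abc V(3) by (auto dest: asymD)
    then have T: "T \<subseteq> V" "card T = 3" "finite T"
      using abc V(2) by (auto simp: T_def)
    then have cV: "card V = card (V - T) + 3"
      using V by (metis card_Diff_subset card_mono le_add_diff_inverse2)
    have "card A \<le> card (A \<inter> T \<times> T) + card (V - T) + card ?B"
    proof (rule card_arcs_delete_le[OF V T(1)])
      fix x y z
      assume *: "x \<in> V - T" "y \<in> T" "z \<in> T" "(x, y) \<in> A \<union> A\<inverse>" "(x, z) \<in> A \<union> A\<inverse>"
      show "y = z"
      proof (rule ccontr)
        assume "y \<noteq> z"
        \<comment> \<open>\<open>t\<close> is the third vertex of the triangle, so \<open>x\<close>
          and \<open>t\<close> both complete the edge \<open>yz\<close> to a triangle.\<close>
        then obtain t where t: "t \<in> T" "(y, z) \<in> A \<union> A\<inverse>" "(y, t) \<in> A \<union> A\<inverse>" "(z, t) \<in> A \<union> A\<inverse>"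
          using * abc unfolding T_def by blast
        then have "x = t"
          using * by (intro less.prems(4)[of y z]) auto
        then show False
          using * t by simp
      qed
    qed
    moreover have asym: "asym (A \<inter> X)" for X
      using V(3) by (auto simp: asym_on_def)
    have "2 * card (A \<inter> T \<times> T) + card T \<le> (card T)\<^sup>2"
      using T asym by (intro card_asym_le) auto
    moreover have "card ?B \<le> (card (V - T))\<^sup>2 div 4 + of_bool (card (V - T) = 3)"
    proof (intro less.hyps asym)
      fix u v w w'
      assume "(u, v) \<in> ?B \<union> ?B\<inverse>" "(u, w) \<in> ?B \<union> ?B\<inverse>" "(v, w) \<in> ?B \<union> ?B\<inverse>"
        "(u, w') \<in> ?B \<union> ?B\<inverse>" "(v, w') \<in> ?B \<union> ?B\<inverse>"
      then show "w = w'"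
        by (intro less.prems(4)[of u v]) auto
    qed (use cV V(1) in auto)
    ultimately have *: "card A \<le> 3 + m + m\<^sup>2 div 4 + of_bool (m = 3)" if "m = card (V - T)" for m
      using T that by simp
    obtain m where m: "m = card (V - T)" by blast
    \<comment> \<open>Since 12 + 4m + m^2 \<le> (m + 3)^2 amounts to 2m \<ge> 3, only small m is
      delicate: m = 0 uses the correction term on the right, m = 1 is saved by rounding, and m = 3
      has just enough slack for the correction on the left.\<close>
    have "3 + m + m\<^sup>2 div 4 + of_bool (m = 3) \<le> (m + 3)\<^sup>2 div 4 + of_bool (m + 3 = 3)"
    proof -
      consider "m = 0" | "m = 1" | "m = 2" | "m = 3" | "m \<ge> 4" by linarith
      then show ?thesis
      proof cases
        case 5
        have "3 + m + m\<^sup>2 div 4 = (12 + 4 * m + m\<^sup>2) div 4" by simp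
        also have "\<dots> \<le> (m + 3)\<^sup>2 div 4"
          using 5 by (intro div_le_mono) (simp add: power2_eq_square algebra_simps)
        finally show ?thesis using 5 by simp
      qed simp_all
    qed
    then show ?thesis
      using *[OF m] cV m by simp
  qed
qed

lemma vwalk_2I:
  assumes "pair_digraph G" "(u, v) \<in> parcs G"
  shows "vwalk [u, v] (with_proj G)"
proof -
  interpret pair_digraph G by fact
  show ?thesis using assms(2) by (auto simp: vwalk_def in_arcsD1 in_arcsD2)
qed

lemma vwalk_3I:
  assumes "pair_digraph G" "(u, v) \<in> parcs G" "(v, w) \<in> parcs G"
  shows "vwalk [u, v, w] (with_proj G)"
proof -
  interpret pair_digraph G by fact
  show ?thesis using assms(2,3) by (auto simp: vwalk_def in_arcsD1 in_arcsD2)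
qed

lemma k_geodeticD:
  assumes "k_geodetic k G" "vwalk p (with_proj G)" "vwalk q (with_proj G)"
    "hd p = hd q" "last p = last q" "vwalk_length p \<le> k" "vwalk_length q \<le> k"
  shows "p = q"
proof -
  have "hd p \<in> pverts G" "last p \<in> pverts G"
    using assms(2) by (auto simp: vwalk_def)
  then show ?thesis
    using assms unfolding k_geodetic_def by metis
qed

text \<open>Walks of length at most 2 already force the hypotheses of
  \<open>card_arcs_le_if_unique_triangles\<close>. Three vertices are excluded because the cyclic
  triangle is 2-geodetic with 3 arcs, whereas 9 div 4 = 2.\<close>

lemma k_geodetic_card_parcs_le:
  assumes G: "pair_digraph G" and geo: "k_geodetic k G" and "k \<ge> 2" and "card (pverts G) \<noteq> 3"
  shows "card (parcs G) \<le> (card (pverts G))\<^sup>2 div 4"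
proof -
  interpret pair_digraph G by fact
  note walks = vwalk_2I[OF G] vwalk_3I[OF G]
  have asym: "asym (parcs G)"
  proof (rule asymI)
    fix u v assume uv: "(u, v) \<in> parcs G"
    show "(v, u) \<notin> parcs G"
    proof
      assume "(v, u) \<in> parcs G"
      moreover have "vwalk [u] (with_proj G)"
        using uv by (auto simp: vwalk_def in_arcsD1)
      \<comment> \<open>A 2-cycle competes with the trivial walk of length 0 at
        \<open>u\<close>.\<close>
      ultimately have "[u] = [u, v, u]"
        using uv walks \<open>k \<ge> 2\<close> by (intro k_geodeticD[OF geo]) auto
      then show False by simp
    qed
  qed
  have no_shortcut: "(u, w) \<notin> parcs G" if "(u, v) \<in> parcs G" "(v, w) \<in> parcs G" for u v w
  proof
    assume "(u, w) \<in> parcs G"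
    then have "[u, w] = [u, v, w]"
      using that walks \<open>k \<ge> 2\<close> by (intro k_geodeticD[OF geo]) auto
    then show False by simp
  qed
  have unique_mid: "v = v'"
    if "(u, v) \<in> parcs G" "(v, w) \<in> parcs G" "(u, v') \<in> parcs G" "(v', w) \<in> parcs G" for u v v' w
  proof -
    have "[u, v, w] = [u, v', w]"
      using that walks \<open>k \<ge> 2\<close> by (intro k_geodeticD[OF geo]) auto
    then show ?thesis by simp
  qed
  let ?S = "parcs G \<union> (parcs G)\<inverse>"
  \<comment> \<open>Every other orientation of the triangle is transitive, hence has an arc parallel
    to a walk of length 2.\<close>
  have cyclic: "(v, w) \<in> parcs G \<and> (w, u) \<in> parcs G"
    if "(u, v) \<in> parcs G" "(u, w) \<in> ?S" "(v, w) \<in> ?S" for u v w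
    using that no_shortcut by blast
  have "card (parcs G) \<le> (card (pverts G))\<^sup>2 div 4 + of_bool (card (pverts G) = 3)"
  proof (rule card_arcs_le_if_unique_triangles[OF pair_finite_verts _ asym])
    show "parcs G \<subseteq> pverts G \<times> pverts G"
      by (auto intro: in_arcsD1 in_arcsD2)
    fix u v w w'
    assume *: "(u, v) \<in> ?S" "(u, w) \<in> ?S" "(v, w) \<in> ?S" "(u, w') \<in> ?S" "(v, w') \<in> ?S"
    then consider "(u, v) \<in> parcs G" | "(v, u) \<in> parcs G" by blast
    \<comment> \<open>Both \<open>w\<close> and \<open>w'\<close> are midpoints of walks of length 2
      running against the arc between \<open>u\<close> and \<open>v\<close>.\<close>
    then show "w = w'"
      by cases (use * cyclic unique_mid in metis)+
  qed
  then show ?thesis using \<open>card (pverts G) \<noteq> 3\<close> by simp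
qed

text \<open>No arc can be followed by another, so a walk has at most two vertices and is determined
  by its ends. This works for every \<open>k\<close>.\<close>

lemma k_geodetic_bipartite:
  fixes X Y :: "'a set"
  assumes "finite X" "finite Y" "X \<inter> Y = {}"
  defines "G \<equiv> \<lparr>pverts = X \<union> Y, parcs = X \<times> Y\<rparr>"
  shows "pair_digraph G" "k_geodetic k G"
proof -
  show "pair_digraph G"
    using assms by unfold_locales auto
  have walk: "p = [hd p] \<and> hd p = last p \<or> p = [hd p, last p] \<and> hd p \<in> X \<and> last p \<in> Y"
    if "vwalk p (with_proj G)" for p
  proof -
    \<comment> \<open>In the last case \<open>y\<close> would be the head of one arc and the tail of
      the next, hence in both \<open>X\<close> and \<open>Y\<close>.\<close>
    consider "p = []" | x where "p = [x]" | x y where "p = [x, y]" | x y z r where "p = x # y # z # r"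
      by (metis list.exhaust)
    then show ?thesis
      by cases (use that assms(3) in \<open>auto simp: vwalk_def G_def\<close>)
  qed
  show "k_geodetic k G"
    unfolding k_geodetic_def using walk \<open>X \<inter> Y = {}\<close> by (metis disjoint_iff)
qed

theorem theorem8:
  fixes n k :: nat
  assumes "n \<ge> 4" and "k \<ge> 2"
  shows "ex n k = nat \<lfloor>(real n)\<^sup>2 / 4\<rfloor>"
proof -
  have "ex n k \<in> geodetic_sizes n k"
    unfolding ex_def using finite_geodetic_sizes geodetic_sizes_nonempty by (rule Max_in)
  then have "ex n k \<le> n\<^sup>2 div 4"
    using assms k_geodetic_card_parcs_le by (fastforce simp: geodetic_sizes_def)
  moreover have "n\<^sup>2 div 4 \<le> ex n k"
  proof -
    \<comment> \<open>Parts of sizes \<open>m\<close> and \<open>n - m\<close> are as equal as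
      possible, which maximizes their product.\<close>
    define m where "m = n div 2"
    let ?G = "\<lparr>pverts = {..<m} \<union> {m..<n}, parcs = {..<m} \<times> {m..<n}\<rparr>"
    have "m \<le> n" by (simp add: m_def)
    then have "{..<m} \<union> {m..<n} = {..<n}" by auto
    then have "card (pverts ?G) = n" by simp
    then have "card (parcs ?G) \<le> ex n k"
      by (rule card_parcs_le_ex[rotated]) (rule k_geodetic_bipartite; auto)+
    moreover have "n\<^sup>2 div 4 = m * (n - m)"
    proof (cases "even n")
      case True
      then obtain j where "n = 2 * j" by (elim evenE)
      then show ?thesis by (simp add: m_def power2_eq_square)
    next
      case False
      then obtain j where j: "n = 2 * j + 1" by (elim oddE)
      then have "n\<^sup>2 = 4 * (j * (j + 1)) + 1"
        by (simp add: power2_eq_square algebra_simps)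
      then have "n\<^sup>2 div 4 = j * (j + 1)" by presburger
      then show ?thesis using j by (simp add: m_def)
    qed
    ultimately show ?thesis by (simp add: card_cartesian_product)
  qed
  moreover have "nat \<lfloor>(real n)\<^sup>2 / 4\<rfloor> = n\<^sup>2 div 4"
    using floor_divide_of_nat_eq[of "n\<^sup>2" 4, where 'a = real] by simp
  ultimately show ?thesis by simp
qed

end
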